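(* Let $q$ be a prime power, $m\ge 1$ an integer, $g\in\mathbb{F}_q[x]$ a monic divisor of $x^m-1$, and $\alpha\in\mathbb{F}_{q^m}$ a normal element over $\mathbb{F}_q$. Then $$\sum_{\chi}\chi(\alpha)=\mu(g),$$ where the sum runs over all additive characters $\chi$ of $\mathbb{F}_{q^m}$ of $\mathbb{F}_q$-Order $g$.
   Context: For $l(x)=\sum_{i=0}^n a_i x^i\in\mathbb{F}_q[x]$ and $\gamma\in\mathbb{F}_{q^m}$, write $l\circ\gamma=\sum_{i=0}^n a_i\gamma^{q^i}$. An element $\alpha\in\mathbb{F}_{q^m}$ is normal over $\mathbb{F}_q$ if $\alpha,\alpha^q,\dots,\alpha^{q^{m-1}}$ form a basis of $\mathbb{F}_{q^m}$ over $\mathbb{F}_q$. An additive character of $\mathbb{F}_{q^m}$ is a group homomorphism $\chi:(\mathbb{F}_{q^m},+)\to\mathbb{C}^*$; its $\mathbb{F}_q$-Order is the unique monic polynomial $f\in\mathbb{F}_q[x]$ of least degree such that $\chi(f\circ\gamma)=1$ for all $\gamma\in\mathbb{F}_{q^m}$. For a nonzero $f\in\mathbb{F}_q[x]$, $\mu(f)=(-1)^r$ if $f$ is the product of $r$ distinct irreducible polynomials (with $\mu(1)=1$), and $\mu(f)=0$ otherwise. *)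

theory Defs
  imports Complex_Main "HOL-Library.Cardinality" "HOL-Computational_Algebra.Computational_Algebra"
begin

text \<open>
  The extension of \<open>F\<^sub>q\<close> by \<open>F\<^sub>q\<^sup>m\<close> is given by two finite fields
  \<open>'k\<close> (with \<open>q = CARD('k)\<close>) and \<open>'l\<close>, together with an embedding
  \<open>\<iota> :: 'k \<Rightarrow> 'l\<close> that makes \<open>'l\<close> a vector space over \<open>'k\<close>.
\<close>

definition field_embedding :: "('k::field \<Rightarrow> 'l::field) \<Rightarrow> bool" where
  "field_embedding \<iota> \<longleftrightarrow> \<iota> 1 = 1 \<and>
     (\<forall>x y. \<iota> (x + y) = \<iota> x + \<iota> y) \<and> (\<forall>x y. \<iota> (x * y) = \<iota> x * \<iota> y)"

definition scale_by :: "('k::field \<Rightarrow> 'l::field) \<Rightarrow> 'k \<Rightarrow> 'l \<Rightarrow> 'l" where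
  "scale_by \<iota> c x = \<iota> c * x"

lemma vector_space_scale_by:
  assumes "field_embedding \<iota>"
  shows "vector_space (scale_by \<iota>)"
  using assms by unfold_locales (auto simp: field_embedding_def scale_by_def algebra_simps)

definition circ :: "('k::finite_field \<Rightarrow> 'l::finite_field) \<Rightarrow> 'k poly \<Rightarrow> 'l \<Rightarrow> 'l" where
  "circ \<iota> l \<gamma> = (\<Sum>i\<le>degree l. \<iota> (coeff l i) * \<gamma> ^ (CARD('k) ^ i))"

text \<open>
  A basis is a family: the \<open>m\<close> conjugates must be pairwise distinct as well as
  linearly independent and spanning.
\<close>

definition normal_element ::
  "('k::finite_field \<Rightarrow> 'l::finite_field) \<Rightarrow> nat \<Rightarrow> 'l \<Rightarrow> bool" where
  "normal_element \<iota> m \<alpha> \<longleftrightarrow>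
     (let conj = (\<lambda>i. \<alpha> ^ (CARD('k) ^ i)) in
        inj_on conj {..<m} \<and>
        \<not> module.dependent (scale_by \<iota>) (conj ` {..<m}) \<and>
        module.span (scale_by \<iota>) (conj ` {..<m}) = UNIV)"

definition additive_character :: "('l::finite_field \<Rightarrow> complex) \<Rightarrow> bool" where
  "additive_character \<chi> \<longleftrightarrow>
     (\<forall>x. \<chi> x \<noteq> 0) \<and> (\<forall>x y. \<chi> (x + y) = \<chi> x * \<chi> y)"

definition annihilates ::
  "('k::finite_field \<Rightarrow> 'l::finite_field) \<Rightarrow> 'k poly \<Rightarrow> ('l \<Rightarrow> complex) \<Rightarrow> bool" where
  "annihilates \<iota> f \<chi> \<longleftrightarrow> (\<forall>\<gamma>. \<chi> (circ \<iota> f \<gamma>) = 1)"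

definition is_Fq_Order ::
  "('k::finite_field \<Rightarrow> 'l::finite_field) \<Rightarrow> ('l \<Rightarrow> complex) \<Rightarrow> 'k poly \<Rightarrow> bool" where
  "is_Fq_Order \<iota> \<chi> f \<longleftrightarrow>
     lead_coeff f = 1 \<and> annihilates \<iota> f \<chi> \<and>
     (\<forall>h. lead_coeff h = 1 \<longrightarrow> annihilates \<iota> h \<chi> \<longrightarrow> degree f \<le> degree h)"

definition Fq_Order ::
  "('k::finite_field \<Rightarrow> 'l::finite_field) \<Rightarrow> ('l \<Rightarrow> complex) \<Rightarrow> 'k poly" where
  "Fq_Order \<iota> \<chi> = (THE f. is_Fq_Order \<iota> \<chi> f)"

text \<open>
  Irreducible factors are normalised to be monic and a constant factor is split off, so that
  ``distinct'' means pairwise non-associated and a nonzero constant has no factors.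
\<close>

definition distinct_irreducible_product :: "'k::field poly \<Rightarrow> nat \<Rightarrow> bool" where
  "distinct_irreducible_product f r \<longleftrightarrow>
     (\<exists>c P. c \<noteq> 0 \<and> finite P \<and> card P = r \<and>
        (\<forall>p\<in>P. irreducible p \<and> lead_coeff p = 1) \<and> f = smult c (\<Prod>p\<in>P. p))"

definition poly_moebius :: "'k::field poly \<Rightarrow> int" where
  "poly_moebius f =
     (if \<exists>r. distinct_irreducible_product f r
      then (-1) ^ (THE r. distinct_irreducible_product f r) else 0)"


subsection \<open>Well-definedness\<close>

lemma distinct_irreducible_product_factors:
  fixes P :: "'k::field poly set"
  assumes "c \<noteq> 0" "finite P" "\<forall>p\<in>P. irreducible p \<and> lead_coeff p = 1"
  shows "P = {p. irreducible p \<and> lead_coeff p = 1 \<and> p dvd smult c (\<Prod>p\<in>P. p)}"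
proof (intro equalityI subsetI CollectI)
  fix p assume "p \<in> P"
  then show "irreducible p \<and> lead_coeff p = 1 \<and> p dvd smult c (\<Prod>p\<in>P. p)"
    using assms by (auto intro!: dvd_smult dvd_prodI)
next
  fix p assume "p \<in> {p. irreducible p \<and> lead_coeff p = 1 \<and> p dvd smult c (\<Prod>p\<in>P. p)}"
  then have p: "irreducible p" "lead_coeff p = 1" and "p dvd (\<Prod>p\<in>P. p)"
    using assms(1) by (auto simp: dvd_smult_iff)
  moreover have "prime_elem p" using p(1) by (rule field_poly_irreducible_imp_prime)
  moreover have "\<exists>s\<in>P. p dvd s" if "prime_elem p" "p dvd (\<Prod>p\<in>P. p)"
    using assms(2) that
    by (induction P) (auto simp: prime_elem_dvd_mult_iff)
  ultimately obtain s where s: "s \<in> P" "p dvd s" by blast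
  then obtain t where t: "s = p * t" by (auto simp: dvd_def)
  have "irreducible s" "lead_coeff s = 1" using assms(3) s by auto
  then have "is_unit t" using p(1) t by (auto simp: irreducible_def)
  then obtain d where "t = [:d:]" by (auto simp: is_unit_poly_iff)
  moreover have "lead_coeff t = 1"
    using \<open>lead_coeff s = 1\<close> p(2) t by (simp add: lead_coeff_mult)
  ultimately have "t = 1" by (simp add: one_pCons)
  then show "p \<in> P" using s t by simp
qed

lemma distinct_irreducible_product_unique:
  assumes "distinct_irreducible_product f r" "distinct_irreducible_product f s"
  shows "r = s"
proof -
  obtain c P where P: "c \<noteq> 0" "finite P" "card P = r" "f = smult c (\<Prod>p\<in>P. p)"
    "\<forall>p\<in>P. irreducible p \<and> lead_coeff p = 1"
    using assms(1) unfolding distinct_irreducible_product_def by blast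
  obtain d Q where Q: "d \<noteq> 0" "finite Q" "card Q = s" "f = smult d (\<Prod>p\<in>Q. p)"
    "\<forall>p\<in>Q. irreducible p \<and> lead_coeff p = 1"
    using assms(2) unfolding distinct_irreducible_product_def by blast
  have "P = Q"
    using distinct_irreducible_product_factors[OF P(1,2,5)]
      distinct_irreducible_product_factors[OF Q(1,2,5)] P(4) Q(4) by simp
  then show ?thesis using P(3) Q(3) by simp
qed

lemma field_embedding_0: "field_embedding \<iota> \<Longrightarrow> \<iota> 0 = 0"
  unfolding field_embedding_def by (metis add_cancel_right_right)

lemma circ_eq_sum:
  fixes \<iota> :: "'k::finite_field \<Rightarrow> 'l::finite_field"
  assumes "field_embedding \<iota>" "degree l \<le> n"
  shows "circ \<iota> l \<gamma> = (\<Sum>i\<le>n. \<iota> (coeff l i) * \<gamma> ^ (CARD('k) ^ i))"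
  unfolding circ_def using assms
  by (intro sum.mono_neutral_left) (auto simp: coeff_eq_0 field_embedding_0)

lemma circ_add:
  assumes "field_embedding \<iota>"
  shows "circ \<iota> (f + g) \<gamma> = circ \<iota> f \<gamma> + circ \<iota> g \<gamma>"
proof -
  let ?n = "max (degree f) (degree g)"
  have "degree (f + g) \<le> ?n" by (rule degree_add_le_max)
  then show ?thesis using assms
    by (simp add: circ_eq_sum[of _ _ ?n] sum.distrib field_embedding_def algebra_simps)
qed

lemma circ_smult:
  fixes \<iota> :: "'k::finite_field \<Rightarrow> 'l::finite_field"
  assumes "field_embedding \<iota>"
  shows "circ \<iota> (smult c f) \<gamma> = circ \<iota> f (\<iota> c * \<gamma>)"
proof -
  have pow: "\<iota> x ^ n = \<iota> (x ^ n)" for x n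
    using assms by (induction n) (auto simp: field_embedding_def)
  have mult: "\<iota> (x * y) = \<iota> x * \<iota> y" for x y
    using assms by (auto simp: field_embedding_def)
  have "degree (smult c f) \<le> degree f" by (rule degree_smult_le)
  then show ?thesis using assms
    by (simp add: circ_eq_sum[of _ _ "degree f"] mult power_mult_distrib pow
        finite_field_power_card_power_eq_same mult_ac)
qed

lemma Fq_Order_unique:
  assumes emb: "field_embedding \<iota>" and chi: "additive_character \<chi>"
    and f: "is_Fq_Order \<iota> \<chi> f" and g: "is_Fq_Order \<iota> \<chi> g"
  shows "f = g"
proof (rule ccontr)
  assume neq: "f \<noteq> g"
  define h where "h = f + smult (-1) g"
  define k where "k = smult (inverse (lead_coeff h)) h"
  have h0: "h \<noteq> 0" using neq by (simp add: h_def)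
  have mult: "\<chi> (x + y) = \<chi> x * \<chi> y" for x y using chi by (auto simp: additive_character_def)
  have "annihilates \<iota> h \<chi>"
    using f g by (simp add: annihilates_def h_def is_Fq_Order_def mult
        circ_add[OF emb] circ_smult[OF emb] del: smult_minus_left)
  then have "annihilates \<iota> k \<chi>"
    by (simp add: annihilates_def k_def circ_smult[OF emb])
  moreover have "lead_coeff k = 1" using h0 by (simp add: k_def)
  ultimately have le: "degree f \<le> degree k" using f by (simp add: is_Fq_Order_def)
  have deg: "degree f = degree g" using f g by (auto simp: is_Fq_Order_def intro: antisym)
  have "degree k = degree h" using h0 by (simp add: k_def)
  moreover have "degree h \<le> degree f" using deg by (simp add: h_def degree_diff_le)
  moreover have "coeff h (degree f) = 0" using f g deg by (simp add: h_def is_Fq_Order_def)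
  ultimately have "degree h = degree f" "lead_coeff h = 0" using le by auto
  then show False using h0 by (metis leading_coeff_0_iff)
qed

lemma Fq_Order_exists:
  fixes \<iota> :: "'k::finite_field \<Rightarrow> 'l::finite_field"
  assumes emb: "field_embedding \<iota>" and chi: "additive_character \<chi>"
    and "CARD('l) = CARD('k) ^ m" "m \<ge> 1"
  shows "\<exists>f. is_Fq_Order \<iota> \<chi> f"
proof -
  let ?A = "\<lambda>f. lead_coeff f = 1 \<and> annihilates \<iota> f \<chi>"
  let ?f = "monom 1 m + smult (-1) 1 :: 'k poly"
  have e: "\<iota> 1 = 1" "\<iota> 0 = 0" using emb field_embedding_0 by (auto simp: field_embedding_def)
  have minus: "\<iota> (-1) = -1"
    using emb e unfolding field_embedding_def by (metis add.right_inverse add_eq_0_iff)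
  have "\<chi> 0 = \<chi> 0 * \<chi> 0" "\<chi> 0 \<noteq> 0"
    using chi unfolding additive_character_def by (metis add.right_neutral, metis)
  then have chi0: "\<chi> 0 = 1" by simp
  have sum: "(\<Sum>i\<le>m. \<iota> (if m = i then 1 else 0) * \<gamma> ^ (CARD('k) ^ i)) = \<gamma> ^ (CARD('k) ^ m)" for \<gamma>
    using e by (subst sum.mono_neutral_cong_right[of "{..m}" "{m}"]) auto
  have "circ \<iota> (monom 1 m) \<gamma> = \<gamma>" for \<gamma>
    using assms(3) sum[of \<gamma>] finite_field_power_card_eq_same[of \<gamma>]
    by (simp add: circ_eq_sum[OF emb, of _ m] degree_monom_le coeff_monom)
  moreover have "circ \<iota> 1 \<gamma> = \<gamma>" for \<gamma> by (simp add: circ_def e)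
  ultimately have "circ \<iota> ?f \<gamma> = 0" for \<gamma>
    by (subst circ_add[OF emb], subst circ_smult[OF emb]) (simp only: minus, simp)
  then have "annihilates \<iota> ?f \<chi>" by (simp only: annihilates_def chi0) simp
  moreover have "degree ?f = m"
    using assms(4) by (subst degree_add_eq_left) (auto simp: degree_monom_eq)
  then have "lead_coeff ?f = 1" using assms(4) by (simp add: coeff_eq_0)
  ultimately have "?A ?f" by simp
  from ex_has_least_nat[of ?A, OF this, of degree] show ?thesis
    unfolding is_Fq_Order_def by blast
qed

lemma is_Fq_Order_Fq_Order:
  fixes \<iota> :: "'k::finite_field \<Rightarrow> 'l::finite_field"
  assumes "field_embedding \<iota>" "additive_character \<chi>" "CARD('l) = CARD('k) ^ m" "m \<ge> 1"
  shows "is_Fq_Order \<iota> \<chi> (Fq_Order \<iota> \<chi>)"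
proof -
  obtain f where f: "is_Fq_Order \<iota> \<chi> f" using Fq_Order_exists[OF assms] by blast
  show ?thesis unfolding Fq_Order_def
    by (rule theI[of _ f]) (use f Fq_Order_unique[OF assms(1,2)] in blast)+
qed

end

theory Submission
  imports Defs
begin

text \<open>
  Write \<open>R = F\<^sub>q[x]\<close>. The operation \<open>circ\<close> makes the big field an \<open>R\<close>-module in which \<open>x\<close> acts
  as the Frobenius map, so the polynomials annihilating a character form an ideal, generated by
  the Order of the character. Let \<open>S(d)\<close> be the sum of \<open>\<chi>(\<alpha>)\<close> over the characters of Order \<open>d\<close>.
  Grouping the characters annihilated by \<open>g\<close> according to their Order gives
  \<open>T(g) = \<Sum>d. S(d)\<close>, where \<open>d\<close> runs over the monic divisors of \<open>g\<close> and \<open>T(g)\<close> is the sum of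
  \<open>\<chi>(\<alpha>)\<close> over the characters that are trivial on the subgroup \<open>g \<circ> L\<close> of the big field \<open>L\<close>.

  For \<open>g = 1\<close> only the trivial character is left and \<open>T(1) = 1\<close>. For \<open>g \<noteq> 1\<close> the normal element
  \<open>\<alpha>\<close> is not in \<open>g \<circ> L\<close>: otherwise the cofactor \<open>(x\<^sup>m - 1)/g\<close>, of degree below \<open>m\<close>, would kill
  \<open>\<alpha>\<close>, which is a linear relation between its conjugates. Hence some character trivial on \<open>g \<circ> L\<close>
  is not \<open>1\<close> at \<open>\<alpha>\<close> (\<open>separating_character\<close>), and multiplication by it permutes the
  characters summed in \<open>T(g)\<close>, so \<open>T(g) = 0\<close> (\<open>sum_annihilated_characters\<close>).

  Thus \<open>S\<close> satisfies the same recursion \<open>\<Sum>d. S(d) = [g = 1]\<close> over the divisors of \<open>x\<^sup>m - 1\<close>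
  as the Moebius function (\<open>sum_poly_moebius\<close>), and the recursion determines its solution
  (\<open>poly_moebius_unique\<close>).
\<close>

section \<open>The Moebius function of polynomials\<close>

lemma finite_bounded_degree: "finite {f :: 'k::{finite,zero} poly. degree f \<le> n}"
proof -
  have "{f :: 'k poly. degree f \<le> n} \<subseteq> Poly ` {xs. set xs \<subseteq> UNIV \<and> length xs \<le> Suc n}"
  proof
    fix f :: "'k poly" assume "f \<in> {f. degree f \<le> n}"
    then have "length (coeffs f) \<le> Suc n" by (cases "f = 0") (auto simp: length_coeffs)
    moreover have "f = Poly (coeffs f)" by simp
    ultimately show "f \<in> Poly ` {xs. set xs \<subseteq> UNIV \<and> length xs \<le> Suc n}" by blast
  qed
  then show ?thesis by (rule finite_subset) (intro finite_imageI finite_lists_length_le, simp)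
qed

lemma finite_poly_divisors:
  fixes g :: "'k::{finite,field} poly"
  assumes "g \<noteq> 0"
  shows "finite {d. d dvd g}"
  by (rule finite_subset[OF _ finite_bounded_degree[of "degree g"]])
    (use assms in \<open>auto intro: dvd_imp_degree_le\<close>)

lemma monic_dvd_degree_eq:
  fixes d g :: "'k::field poly"
  assumes "d dvd g" "degree d = degree g" "lead_coeff d = 1" "lead_coeff g = 1"
  shows "d = g"
proof -
  obtain t where t: "g = d * t" using assms(1) by (auto simp: dvd_def)
  have "t \<noteq> 0" "d \<noteq> 0" using t assms by auto
  then have "degree t = 0" using t assms(2) by (simp add: degree_mult_eq)
  moreover have "lead_coeff t = 1" using assms(3,4) by (simp add: t lead_coeff_mult)
  ultimately have "t = 1" by (metis degree_eq_zeroE lead_coeff_pCons(2) one_pCons)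
  then show ?thesis using t by simp
qed

lemma monic_degree_0:
  fixes g :: "'k::field poly"
  assumes "lead_coeff g = 1" "degree g = 0"
  shows "g = 1"
  using monic_dvd_degree_eq[of 1 g] assms by simp

lemma monic_irreducible_divisor:
  fixes g :: "'k::field poly"
  assumes "lead_coeff g = 1" "g \<noteq> 1"
  obtains p where "irreducible p" "lead_coeff p = 1" "p dvd g"
proof -
  let ?A = "\<lambda>p. lead_coeff p = 1 \<and> p dvd g \<and> degree p > 0"
  have "?A g" using assms monic_degree_0 by auto
  from ex_has_least_nat[of ?A, OF this, of degree]
  obtain p where p: "?A p" and least: "\<And>d. ?A d \<Longrightarrow> degree p \<le> degree d" by blast
  have "irreducible p"
  proof (rule irreducibleI)
    show "p \<noteq> 0" using p by auto
    show "\<not> is_unit p" using p by (auto simp: is_unit_poly_iff)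
    fix a b assume ab: "p = a * b"
    have nz: "a \<noteq> 0" "b \<noteq> 0" using ab p by auto
    show "is_unit a \<or> is_unit b"
    proof (cases "degree a = 0")
      case True
      then show ?thesis using nz by (auto simp: is_unit_iff_degree)
    next
      case False
      define a' where "a' = smult (inverse (lead_coeff a)) a"
      have "a dvd g" using p ab dvd_mult_left by blast
      then have "a' dvd g" using nz by (simp add: a'_def smult_dvd)
      then have "?A a'" using False nz by (simp add: a'_def)
      from least[OF this] have "degree p \<le> degree a" using nz by (simp add: a'_def)
      then have "degree b = 0" using nz by (simp add: ab degree_mult_eq)
      then show ?thesis using nz by (auto simp: is_unit_iff_degree)
    qed
  qed
  then show ?thesis using that p by blast
qed

text \<open>
  The primes in \<open>P\<close> are pairwise non-associated because they are monic, so each of them divides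
  the cofactor left by the others.
\<close>
lemma prod_monic_irreducibles_dvd:
  fixes g :: "'k::field poly"
  assumes "finite P" "\<forall>p\<in>P. irreducible p \<and> lead_coeff p = 1" "\<forall>p\<in>P. p dvd g"
  shows "\<Prod>P dvd g"
  using assms
proof (induction P)
  case (insert p P)
  then have "\<Prod>P dvd g" by simp
  then obtain t where t: "g = \<Prod>P * t" by (auto simp: dvd_def)
  have "\<not> p dvd \<Prod>P"
    using distinct_irreducible_product_factors[of 1 P] insert by auto
  moreover have "p dvd \<Prod>P * t" "prime_elem p"
    using insert t field_poly_irreducible_imp_prime by auto
  ultimately have "p dvd t" by (simp add: prime_elem_dvd_mult_iff)
  then show ?case using insert t by (simp add: mult.commute mult_dvd_mono)
qed simp

lemma poly_moebius_eq:
  assumes "distinct_irreducible_product f r"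
  shows "poly_moebius f = (-1) ^ r"
proof -
  have "(THE r. distinct_irreducible_product f r) = r"
    using assms distinct_irreducible_product_unique by blast
  then show ?thesis using assms by (auto simp: poly_moebius_def)
qed

lemma monic_prod:
  fixes P :: "'k::field poly set"
  assumes "\<forall>p\<in>P. lead_coeff p = 1"
  shows "lead_coeff (\<Prod>P) = 1"
  using assms by (simp add: lead_coeff_prod)

text \<open>
  Only squarefree divisors contribute, and these correspond to the subsets of the set of
  irreducible divisors of \<open>g\<close>; over the subsets of a nonempty finite set the signs cancel.
\<close>
lemma sum_poly_moebius:
  fixes g :: "'k::{finite,field} poly"
  assumes "lead_coeff g = 1"
  shows "(\<Sum>d | lead_coeff d = 1 \<and> d dvd g. poly_moebius d) = (if g = 1 then 1 else 0)"
proof -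
  define A where "A = {p. irreducible p \<and> lead_coeff p = 1 \<and> p dvd g}"
  have "g \<noteq> 0" using assms by auto
  then have fin: "finite {d. d dvd g}" by (rule finite_poly_divisors)
  then have finA: "finite A" by (rule rev_finite_subset) (auto simp: A_def)
  have sub: "finite P" "\<forall>p\<in>P. irreducible p \<and> lead_coeff p = 1" "\<forall>p\<in>P. p dvd g" if "P \<subseteq> A" for P
    using that finA by (auto simp: A_def intro: finite_subset)
  have factors: "P = {p. irreducible p \<and> lead_coeff p = 1 \<and> p dvd \<Prod>P}" if "P \<subseteq> A" for P
    using distinct_irreducible_product_factors[of 1 P] sub[OF that] by simp
  have inj: "inj_on Prod (Pow A)"
  proof (rule inj_onI)
    fix P Q assume "P \<in> Pow A" "Q \<in> Pow A" "\<Prod>P = \<Prod>Q"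
    then show "P = Q" using factors[of P] factors[of Q] by simp
  qed
  have dip: "distinct_irreducible_product (\<Prod>P) (card P)" if "P \<subseteq> A" for P
    unfolding distinct_irreducible_product_def
    using sub[OF that] by (intro exI[of _ 1] exI[of _ P]) simp
  have "(\<Sum>d | lead_coeff d = 1 \<and> d dvd g. poly_moebius d) = (\<Sum>d\<in>Prod ` Pow A. poly_moebius d)"
  proof (rule sum.mono_neutral_right)
    show "finite {d. lead_coeff d = 1 \<and> d dvd g}" using fin by (rule rev_finite_subset) auto
    show "Prod ` Pow A \<subseteq> {d. lead_coeff d = 1 \<and> d dvd g}"
    proof
      fix d assume "d \<in> Prod ` Pow A"
      then obtain P where P: "d = \<Prod>P" "P \<subseteq> A" by blast
      have "lead_coeff d = 1" unfolding P(1) using sub(2)[OF P(2)] by (intro monic_prod) simp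
      moreover have "d dvd g"
        unfolding P(1) using sub[OF P(2)] by (rule prod_monic_irreducibles_dvd)
      ultimately show "d \<in> {d. lead_coeff d = 1 \<and> d dvd g}" by simp
    qed
    show "\<forall>d\<in>{d. lead_coeff d = 1 \<and> d dvd g} - Prod ` Pow A. poly_moebius d = 0"
    proof
      fix d assume d: "d \<in> {d. lead_coeff d = 1 \<and> d dvd g} - Prod ` Pow A"
      have "\<not> distinct_irreducible_product d r" for r
      proof
        assume "distinct_irreducible_product d r"
        then obtain c P where P: "c \<noteq> 0" "finite P" "d = smult c (\<Prod>P)"
          "\<forall>p\<in>P. irreducible p \<and> lead_coeff p = 1"
          unfolding distinct_irreducible_product_def by blast
        have "c = 1" using d P monic_prod[of P] by simp
        then have "d = \<Prod>P" using P by simp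
        moreover have "p dvd g" if "p \<in> P" for p
          using dvd_prodI[OF P(2) that, of "\<lambda>x. x"] d \<open>d = \<Prod>P\<close> by (auto intro: dvd_trans)
        then have "P \<subseteq> A" using P by (auto simp: A_def)
        ultimately show False using d by blast
      qed
      then show "poly_moebius d = 0" by (simp add: poly_moebius_def)
    qed
  qed
  also have "\<dots> = (\<Sum>P\<in>Pow A. poly_moebius (\<Prod>P))"
    using inj by (simp add: sum.reindex)
  also have "\<dots> = (\<Sum>P\<in>Pow A. (-1) ^ card P)"
    using dip by (intro sum.cong) (auto simp: poly_moebius_eq)
  also have "\<dots> = (\<Prod>p\<in>A. 1 - 1 :: int)"
    using prod_diff_conv_sum[OF finA, of "\<lambda>_. 1 :: int" "\<lambda>_. 1"] by simp
  also have "\<dots> = (if g = 1 then 1 else 0)"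
  proof (cases "g = 1")
    case True
    then have "A = {}" by (auto simp: A_def irreducible_not_unit)
    then show ?thesis using True by simp
  next
    case False
    with assms obtain p where "p \<in> A" using monic_irreducible_divisor unfolding A_def by blast
    then show ?thesis using False finA card_gt_0_iff[of A] by auto
  qed
  finally show ?thesis .
qed

text \<open>
  In the divisor sum for \<open>g\<close> the term at \<open>g\<close> itself is the only one not already determined by
  polynomials of smaller degree.
\<close>
lemma poly_moebius_unique:
  fixes f :: "'k::{finite,field} poly \<Rightarrow> 'a::comm_ring_1"
  assumes sum_f: "\<And>g. lead_coeff g = 1 \<Longrightarrow> g dvd N \<Longrightarrow>
      (\<Sum>d | lead_coeff d = 1 \<and> d dvd g. f d) = (if g = 1 then 1 else 0)"
    and "lead_coeff g = 1" "g dvd N"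
  shows "f g = of_int (poly_moebius g)"
  using assms(2,3)
proof (induction "degree g" arbitrary: g rule: less_induct)
  case less
  let ?D = "{d. lead_coeff d = 1 \<and> d dvd g}"
  let ?\<mu> = "\<lambda>d. of_int (poly_moebius d) :: 'a"
  have g0: "g \<noteq> 0" using less.prems by auto
  have fin: "finite ?D" by (rule rev_finite_subset[OF finite_poly_divisors[OF g0]]) auto
  have IH: "f d = ?\<mu> d" if "d \<in> ?D - {g}" for d
  proof (rule less.hyps)
    have "degree d \<le> degree g" using that g0 by (auto intro: dvd_imp_degree_le)
    moreover have "degree d \<noteq> degree g" using that less.prems monic_dvd_degree_eq[of d g] by auto
    ultimately show "degree d < degree g" by simp
    show "lead_coeff d = 1" using that by simp
    show "d dvd N" using that less.prems(2) by (auto intro: dvd_trans)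
  qed
  have "sum f ?D = of_int (\<Sum>d\<in>?D. poly_moebius d)"
    using sum_f[OF less.prems] sum_poly_moebius[OF less.prems(1)] by simp
  also have "\<dots> = sum ?\<mu> ?D" by simp
  finally have "f g + sum f (?D - {g}) = ?\<mu> g + sum ?\<mu> (?D - {g})"
    using sum.remove[OF fin, of g f] sum.remove[OF fin, of g ?\<mu>] less.prems(1) by simp
  moreover have "sum f (?D - {g}) = sum ?\<mu> (?D - {g})" using IH by (rule sum.cong[OF refl])
  ultimately show ?case by simp
qed

section \<open>The module structure given by the Frobenius map\<close>

lemma field_embedding_of_nat:
  assumes "field_embedding \<iota>"
  shows "\<iota> (of_nat n) = of_nat n"
  using assms field_embedding_0[OF assms] by (induction n) (auto simp: field_embedding_def)

lemma field_embedding_power: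
  assumes "field_embedding \<iota>"
  shows "\<iota> (x ^ n) = \<iota> x ^ n"
  using assms by (induction n) (auto simp: field_embedding_def)

text \<open>
  The polynomial \<open>(X + 1)\<^sup>q - X\<^sup>q - 1\<close> has degree less than \<open>q\<close> and vanishes on the whole
  field, so its coefficients, the inner binomial coefficients, are zero in the field. This gives
  the additivity of the Frobenius map without knowing that \<open>q\<close> is a power of the characteristic.
\<close>
lemma card_choose_eq_0:
  assumes "0 < k" "k < CARD('k::finite_field)"
  shows "of_nat (CARD('k) choose k) = (0 :: 'k)"
proof -
  let ?q = "CARD('k)"
  define f :: "'k poly" where "f = (\<Sum>i\<in>{0<..<?q}. monom (of_nat (?q choose i)) i)"
  have q: "?q > 0" using assms by simp
  have "poly f x = 0" for x
  proof -
    have "x + 1 = (x + 1) ^ ?q" by (simp add: finite_field_power_card_eq_same)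
    also have "\<dots> = (\<Sum>i\<le>?q. of_nat (?q choose i) * x ^ i)" by (simp add: binomial_ring)
    also have "{..?q} = insert 0 (insert ?q {0<..<?q})" using q by auto
    also have "(\<Sum>i\<in>\<dots>. of_nat (?q choose i) * x ^ i) = 1 + (x + poly f x)"
      using q by (simp add: f_def poly_sum poly_monom finite_field_power_card_eq_same)
    finally show ?thesis by simp
  qed
  then have roots: "{x. poly f x = 0} = UNIV" by auto
  have "degree f \<le> ?q - 1"
    unfolding f_def by (intro degree_sum_le) (auto intro: order_trans[OF degree_monom_le])
  then have "degree f < ?q" using q by linarith
  then have "f = 0" using card_poly_roots_bound[of f] roots by auto
  moreover have "coeff f k = of_nat (?q choose k)"
    using assms by (simp add: f_def coeff_sum)
  ultimately show ?thesis by simp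
qed

lemma frobenius_add:
  fixes \<iota> :: "'k::finite_field \<Rightarrow> 'l::field" and x y :: 'l
  assumes "field_embedding \<iota>"
  shows "(x + y) ^ CARD('k) = x ^ CARD('k) + y ^ CARD('k)"
proof -
  let ?q = "CARD('k)"
  have "of_nat (?q choose i) = (0 :: 'l)" if "i \<in> {..?q} - {0, ?q}" for i
  proof -
    have "of_nat (?q choose i) = (0 :: 'k)" using that by (intro card_choose_eq_0) auto
    then show ?thesis using field_embedding_of_nat[OF assms] field_embedding_0[OF assms] by metis
  qed
  then have "(x + y) ^ ?q = (\<Sum>i\<in>{0, ?q}. of_nat (?q choose i) * x ^ i * y ^ (?q - i))"
    unfolding binomial_ring by (intro sum.mono_neutral_right) auto
  then show ?thesis by simp
qed

lemma circ_0: "field_embedding \<iota> \<Longrightarrow> circ \<iota> 0 \<gamma> = 0"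
  by (simp add: circ_def field_embedding_0)

lemma circ_1: "field_embedding \<iota> \<Longrightarrow> circ \<iota> 1 \<gamma> = \<gamma>"
  by (simp add: circ_def field_embedding_def)

lemma circ_pCons:
  fixes \<iota> :: "'k::finite_field \<Rightarrow> 'l::finite_field"
  assumes "field_embedding \<iota>"
  shows "circ \<iota> (pCons a f) \<gamma> = \<iota> a * \<gamma> + circ \<iota> f (\<gamma> ^ CARD('k))"
proof -
  have "degree (pCons a f) \<le> Suc (degree f)" by (rule degree_pCons_le)
  from circ_eq_sum[OF assms this, of \<gamma>] show ?thesis
    by (simp add: circ_def sum.atMost_Suc_shift power_mult del: sum.atMost_Suc)
qed

lemma circ_monom:
  fixes \<iota> :: "'k::finite_field \<Rightarrow> 'l::finite_field"
  assumes "field_embedding \<iota>"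
  shows "circ \<iota> (monom 1 n) \<gamma> = \<gamma> ^ (CARD('k) ^ n)"
proof (induction n arbitrary: \<gamma>)
  case 0
  then show ?case using circ_1[OF assms] by (simp add: monom_0 one_pCons)
next
  case (Suc n)
  then show ?case
    by (simp add: monom_Suc circ_pCons[OF assms] field_embedding_0[OF assms] flip: power_mult)
qed

lemma circ_diff:
  assumes "field_embedding \<iota>"
  shows "circ \<iota> (f - g) \<gamma> = circ \<iota> f \<gamma> - circ \<iota> g \<gamma>"
  using circ_add[OF assms, of "f - g" g \<gamma>] by simp

lemma circ_add_right:
  fixes \<iota> :: "'k::finite_field \<Rightarrow> 'l::finite_field"
  assumes "field_embedding \<iota>"
  shows "circ \<iota> f (\<gamma> + \<delta>) = circ \<iota> f \<gamma> + circ \<iota> f \<delta>"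
  by (induction f arbitrary: \<gamma> \<delta>)
    (simp_all add: circ_0[OF assms] circ_pCons[OF assms] frobenius_add[OF assms] algebra_simps)

lemma circ_0_right:
  fixes \<iota> :: "'k::finite_field \<Rightarrow> 'l::finite_field"
  assumes "field_embedding \<iota>"
  shows "circ \<iota> f 0 = 0"
  using circ_add_right[OF assms, of f 0 0] by (metis add.right_neutral add_left_cancel)

lemma circ_frobenius:
  fixes \<iota> :: "'k::finite_field \<Rightarrow> 'l::finite_field"
  assumes "field_embedding \<iota>"
  shows "circ \<iota> f (\<gamma> ^ CARD('k)) = circ \<iota> f \<gamma> ^ CARD('k)"
proof (induction f arbitrary: \<gamma>)
  case 0
  then show ?case by (simp add: circ_0[OF assms])
next
  case (pCons a f)
  have "\<iota> a ^ CARD('k) = \<iota> a"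
    by (simp add: finite_field_power_card_eq_same flip: field_embedding_power[OF assms])
  then show ?case
    by (simp add: pCons.IH circ_pCons[OF assms] frobenius_add[OF assms] power_mult_distrib)
qed

text \<open>
  Holds because \<open>x\<close> acts as the Frobenius map, which fixes the small field and hence
  commutes with the action of every polynomial.
\<close>
lemma circ_mult:
  fixes \<iota> :: "'k::finite_field \<Rightarrow> 'l::finite_field"
  assumes "field_embedding \<iota>"
  shows "circ \<iota> (f * g) \<gamma> = circ \<iota> f (circ \<iota> g \<gamma>)"
proof (induction f arbitrary: \<gamma>)
  case 0
  then show ?case by (simp add: circ_0[OF assms])
next
  case (pCons a f)
  have smult: "circ \<iota> (smult a g) \<gamma> = \<iota> a * circ \<iota> g \<gamma>"
    using assms circ_eq_sum[OF assms degree_smult_le, of a g \<gamma>]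
    by (simp add: circ_def field_embedding_def sum_distrib_left mult.assoc)
  show ?case
    by (simp add: mult_pCons_left circ_add[OF assms] smult circ_pCons[OF assms] pCons.IH
        circ_frobenius[OF assms] field_embedding_0[OF assms])
qed

lemma normal_element_circ_eq_0:
  fixes \<iota> :: "'k::finite_field \<Rightarrow> 'l::finite_field"
  assumes emb: "field_embedding \<iota>" and normal: "normal_element \<iota> m \<alpha>"
    and "degree h < m" "circ \<iota> h \<alpha> = 0"
  shows "h = 0"
proof -
  interpret vector_space "scale_by \<iota>" by (rule vector_space_scale_by[OF emb])
  define conj where "conj i = \<alpha> ^ (CARD('k) ^ i)" for i
  have inj: "inj_on conj {..<m}" and indep: "independent (conj ` {..<m})"
    using normal by (auto simp: normal_element_def Let_def conj_def[abs_def])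
  define u where "u = coeff h \<circ> the_inv_into {..<m} conj"
  have u: "u (conj i) = coeff h i" if "i < m" for i
    using that inj by (simp add: u_def the_inv_into_f_f)
  obtain n where n: "m = Suc n" "degree h \<le> n" using assms(3) by (cases m) auto
  have "0 = (\<Sum>i<m. \<iota> (coeff h i) * conj i)"
    using assms(4) circ_eq_sum[OF emb n(2), of \<alpha>]
    by (simp add: n(1) lessThan_Suc_atMost conj_def)
  also have "\<dots> = (\<Sum>i<m. scale_by \<iota> (u (conj i)) (conj i))"
    by (intro sum.cong) (auto simp: u scale_by_def)
  also have "\<dots> = (\<Sum>v\<in>conj ` {..<m}. scale_by \<iota> (u v) v)"
    using inj by (simp add: sum.reindex)
  finally have "u v = 0" if "v \<in> conj ` {..<m}" for v
    using independentD[OF indep _ order_refl, of u v] that by simp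
  then have "lead_coeff h = 0" using u[OF assms(3)] assms(3) by force
  then show ?thesis by simp
qed

section \<open>Additive characters\<close>

lemma additive_character_0:
  assumes "additive_character \<chi>"
  shows "\<chi> 0 = 1"
proof -
  have "\<chi> (0 + 0) = \<chi> 0 * \<chi> 0" "\<chi> 0 \<noteq> 0" using assms unfolding additive_character_def by blast+
  then show ?thesis by simp
qed

lemma additive_character_of_nat_mult:
  assumes "additive_character \<chi>"
  shows "\<chi> (of_nat n * x) = \<chi> x ^ n"
  using assms additive_character_0[OF assms]
  by (induction n) (auto simp: additive_character_def algebra_simps)

text \<open>The values of a character are \<open>p\<close>-th roots of unity, where \<open>p\<close> is the characteristic.\<close>
lemma finite_additive_characters: "finite {\<chi> :: 'l::finite_field \<Rightarrow> complex. additive_character \<chi>}"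
proof -
  let ?p = "CHAR('l)"
  have "{\<chi> :: 'l \<Rightarrow> complex. additive_character \<chi>} \<subseteq> UNIV \<rightarrow>\<^sub>E {z. z ^ ?p = 1}"
  proof
    fix \<chi> :: "'l \<Rightarrow> complex" assume "\<chi> \<in> {\<chi>. additive_character \<chi>}"
    then have "\<chi> x ^ ?p = 1" for x
      using additive_character_of_nat_mult[of \<chi> ?p x] additive_character_0[of \<chi>] by simp
    then show "\<chi> \<in> UNIV \<rightarrow>\<^sub>E {z. z ^ ?p = 1}" by auto
  qed
  moreover have "?p \<ge> 1" by (simp add: Suc_le_eq)
  then have "finite (UNIV \<rightarrow>\<^sub>E {z :: complex. z ^ ?p = 1} :: ('l \<Rightarrow> complex) set)"
    by (intro finite_PiE) (auto intro: finite_roots_unity)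
  ultimately show ?thesis by (rule finite_subset)
qed

lemma of_nat_inverse_finite_field:
  assumes "of_nat k \<noteq> (0 :: 'l::finite_field)"
  obtains j where "of_nat j * of_nat k = (1 :: 'l)"
proof -
  have card: "CARD('l) \<ge> 2"
    using card_mono[of UNIV "{0, 1 :: 'l}"] by simp
  \<comment> \<open>Every nonzero element satisfies \<open>x ^ (q' - 1) = 1\<close>, where \<open>q'\<close> is the size of the field.\<close>
  let ?j = "k ^ (CARD('l) - 2)"
  have "(of_nat ?j * of_nat k) * of_nat k = (of_nat k :: 'l) ^ (CARD('l) - 2 + 2)"
    by (simp only: power_add of_nat_power power2_eq_square mult.assoc)
  also have "\<dots> = of_nat k"
    using card finite_field_power_card_eq_same[of "of_nat k :: 'l"]
    by (simp only: le_add_diff_inverse2)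
  finally have "of_nat ?j * of_nat k = (1 :: 'l)" using assms by simp
  then show ?thesis using that by blast
qed

text \<open>
  Enlarge \<open>H\<close> to a subgroup \<open>M\<close> that is maximal among those avoiding \<open>\<alpha>\<close>. By maximality the
  quotient by \<open>M\<close> is generated by the class of \<open>\<alpha>\<close>, so it is cyclic of order \<open>p\<close>, the
  characteristic, and sending \<open>\<alpha>\<close> to a nontrivial \<open>p\<close>-th root of unity defines the character.
  Closure under addition is enough for \<open>H\<close> to be a subgroup, negation being
  multiplication by \<open>p - 1\<close>.
\<close>
lemma separating_character:
  fixes H :: "'l::finite_field set"
  assumes H0: "0 \<in> H" and H_add: "\<And>x y. x \<in> H \<Longrightarrow> y \<in> H \<Longrightarrow> x + y \<in> H" and "\<alpha> \<notin> H"
  obtains \<chi> where "additive_character \<chi>" "\<forall>x\<in>H. \<chi> x = 1" "\<chi> \<alpha> \<noteq> 1"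
proof -
  let ?p = "CHAR('l)"
  let ?A = "\<lambda>M. H \<subseteq> M \<and> (\<forall>x\<in>M. \<forall>y\<in>M. x + y \<in> M) \<and> \<alpha> \<notin> M"
  have "finite {M. ?A M}" "{M. ?A M} \<noteq> {}" using assms by auto
  from finite_has_maximal[OF this]
  obtain M where M: "?A M" and maximal: "\<And>N. ?A N \<Longrightarrow> M \<subseteq> N \<Longrightarrow> M = N" by auto
  have M0: "0 \<in> M" using M H0 by auto
  have M_add: "x + y \<in> M" if "x \<in> M" "y \<in> M" for x y using M that by auto
  have M_mult: "of_nat n * x \<in> M" if "x \<in> M" for n x
    using that M0 M_add by (induction n) (auto simp: algebra_simps)
  have M_uminus: "- x \<in> M" if "x \<in> M" for x
  proof -
    have "of_nat (?p - 1) + 1 = (of_nat (?p - 1 + 1) :: 'l)" by (simp only: of_nat_add of_nat_1)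
    also have "\<dots> = 0" using CHAR_pos[where 'a = 'l] by (simp del: CHAR_pos)
    finally have "of_nat (?p - 1) = (- 1 :: 'l)" by (simp only: eq_neg_iff_add_eq_0)
    then show ?thesis using M_mult[OF that, of "?p - 1"] by simp
  qed
  have M_diff: "x - y \<in> M" if "x \<in> M" "y \<in> M" for x y
    using M_add[OF that(1) M_uminus[OF that(2)]] by simp
  \<comment> \<open>If \<open>x\<close> is not in \<open>M\<close>, the subgroup generated by \<open>M\<close> and \<open>x\<close> contains \<open>\<alpha>\<close>, and the relation can be
    solved for \<open>x\<close>.\<close>
  have cosets: "\<exists>k. x - of_nat k * \<alpha> \<in> M" for x
  proof (cases "x \<in> M")
    case True
    then show ?thesis by (intro exI[of _ 0]) simp
  next
    case False
    define N where "N = {y + of_nat k * x |y k. y \<in> M}"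
    have "M \<subseteq> N" by (force simp: N_def intro: exI[of _ 0])
    moreover have "x \<in> N"
      using M0 unfolding N_def by (force intro: exI[of _ 0] exI[of _ 1])
    ultimately have "M \<noteq> N" using False by auto
    moreover have "\<forall>x\<in>N. \<forall>y\<in>N. x + y \<in> N"
    proof (intro ballI)
      fix a b assume "a \<in> N" "b \<in> N"
      then obtain y z k l where "a = y + of_nat k * x" "b = z + of_nat l * x" "y \<in> M" "z \<in> M"
        unfolding N_def by blast
      then have "a + b = (y + z) + of_nat (k + l) * x" "y + z \<in> M"
        using M_add by (auto simp: algebra_simps)
      then show "a + b \<in> N" unfolding N_def by blast
    qed
    ultimately have "\<alpha> \<in> N" using maximal[of N] M \<open>M \<subseteq> N\<close> by auto
    then obtain y k where yk: "\<alpha> = y + of_nat k * x" "y \<in> M" unfolding N_def by blast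
    then have "of_nat k \<noteq> (0 :: 'l)" using M by auto
    then obtain j where j: "of_nat j * of_nat k = (1 :: 'l)" by (rule of_nat_inverse_finite_field)
    have "x - of_nat j * \<alpha> = - (of_nat j * y)"
      using j by (simp add: yk(1) distrib_left flip: mult.assoc)
    then show ?thesis using M_uminus M_mult yk(2) by metis
  qed
  obtain \<omega> :: complex where \<omega>: "\<omega> ^ ?p = 1" "\<omega> \<noteq> 1"
  proof -
    have p: "prime ?p" by simp
    then have "card {z :: complex. z ^ ?p = 1} = ?p"
      by (intro card_roots_unity_eq) (auto dest: prime_gt_0_nat)
    then have "\<not> {z :: complex. z ^ ?p = 1} \<subseteq> {1}"
      using card_mono[of "{1 :: complex}" "{z. z ^ ?p = 1}"] prime_gt_1_nat[OF p] by auto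
    then show ?thesis using that by blast
  qed
  \<comment> \<open>The exponent is determined modulo \<open>p\<close> only, which is all that powers of \<open>\<omega>\<close> see.\<close>
  have power_eq_if_le: "\<omega> ^ a = \<omega> ^ b"
    if "a \<le> b" and a: "x - of_nat a * \<alpha> \<in> M" and b: "x - of_nat b * \<alpha> \<in> M" for a b x
  proof -
    have "of_nat (b - a) * \<alpha> \<in> M"
      using M_diff[OF a b] \<open>a \<le> b\<close> by (simp add: of_nat_diff algebra_simps)
    have "of_nat (b - a) = (0 :: 'l)"
    proof (rule ccontr)
      assume "of_nat (b - a) \<noteq> (0 :: 'l)"
      then obtain j where "of_nat j * of_nat (b - a) = (1 :: 'l)"
        by (rule of_nat_inverse_finite_field)
      then have "of_nat j * (of_nat (b - a) * \<alpha>) = \<alpha>" by (simp only: mult_1_left flip: mult.assoc)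
      then show False using M_mult[OF \<open>of_nat (b - a) * \<alpha> \<in> M\<close>, of j] M by metis
    qed
    then have "?p dvd b - a" by (simp only: of_nat_eq_0_iff_char_dvd)
    then obtain t where "b = a + ?p * t" using \<open>a \<le> b\<close> by (metis dvd_def le_add_diff_inverse)
    then show ?thesis using \<omega>(1) by (simp add: power_add power_mult)
  qed
  have power_eq: "\<omega> ^ a = \<omega> ^ b" if "x - of_nat a * \<alpha> \<in> M" "x - of_nat b * \<alpha> \<in> M" for a b x
    using power_eq_if_le[OF _ that] power_eq_if_le[OF _ that(2,1)] by (metis nat_le_linear)
  obtain \<kappa> where \<kappa>: "\<And>x. x - of_nat (\<kappa> x) * \<alpha> \<in> M" using cosets by metis
  define \<chi> where "\<chi> x = \<omega> ^ \<kappa> x" for x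
  have \<chi>: "\<chi> x = \<omega> ^ k" if "x - of_nat k * \<alpha> \<in> M" for x k
    unfolding \<chi>_def using \<kappa> that by (rule power_eq)
  have "\<omega> \<noteq> 0" using \<omega>(1) CHAR_pos[where 'a = 'l] by (auto simp: power_0_left)
  moreover have "\<chi> (x + y) = \<chi> x * \<chi> y" for x y
  proof -
    have "x + y - of_nat (\<kappa> x + \<kappa> y) * \<alpha> \<in> M"
      using M_add[OF \<kappa>[of x] \<kappa>[of y]] by (simp add: algebra_simps)
    from \<chi>[OF this] show ?thesis by (simp add: \<chi>_def power_add)
  qed
  ultimately have "additive_character \<chi>" by (auto simp: additive_character_def \<chi>_def)
  moreover have "\<forall>x\<in>H. \<chi> x = 1" using \<chi>[of _ 0] M by auto
  moreover have "\<chi> \<alpha> \<noteq> 1" using \<chi>[of \<alpha> 1] \<omega>(2) M0 by simp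
  ultimately show ?thesis using that by blast
qed

lemma annihilates_1:
  assumes "field_embedding \<iota>"
  shows "annihilates \<iota> 1 \<chi> \<longleftrightarrow> \<chi> = (\<lambda>_. 1)"
  by (auto simp: annihilates_def circ_1[OF assms])

text \<open>
  The annihilators form an ideal; division with remainder shows that a monic element of least
  degree generates it.
\<close>
lemma annihilates_iff_Fq_Order_dvd:
  fixes \<iota> :: "'k::finite_field \<Rightarrow> 'l::finite_field"
  assumes emb: "field_embedding \<iota>" and chi: "additive_character \<chi>"
    and order: "is_Fq_Order \<iota> \<chi> f"
  shows "annihilates \<iota> h \<chi> \<longleftrightarrow> f dvd h"
proof
  assume "f dvd h"
  then obtain s where "h = f * s" by (auto simp: dvd_def)
  then show "annihilates \<iota> h \<chi>"
    using order by (simp add: annihilates_def is_Fq_Order_def circ_mult[OF emb])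
next
  assume h: "annihilates \<iota> h \<chi>"
  have mult: "\<chi> (x + y) = \<chi> x * \<chi> y" for x y using chi by (auto simp: additive_character_def)
  have f: "lead_coeff f = 1" "annihilates \<iota> f \<chi>"
    and least: "\<And>h. lead_coeff h = 1 \<Longrightarrow> annihilates \<iota> h \<chi> \<Longrightarrow> degree f \<le> degree h"
    using order by (auto simp: is_Fq_Order_def)
  define r where "r = h mod f"
  have "annihilates \<iota> r \<chi>"
    unfolding annihilates_def
  proof
    fix \<gamma>
    have "h = f * (h div f) + r" by (simp add: r_def)
    then have "circ \<iota> h \<gamma> = circ \<iota> f (circ \<iota> (h div f) \<gamma>) + circ \<iota> r \<gamma>"
      by (metis circ_add[OF emb] circ_mult[OF emb])
    then have "\<chi> (circ \<iota> h \<gamma>) = \<chi> (circ \<iota> f (circ \<iota> (h div f) \<gamma>)) * \<chi> (circ \<iota> r \<gamma>)"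
      by (simp only: mult)
    then show "\<chi> (circ \<iota> r \<gamma>) = 1" using h f(2) by (simp add: annihilates_def)
  qed
  have "r = 0"
  proof (rule ccontr)
    assume "r \<noteq> 0"
    define r' where "r' = smult (inverse (lead_coeff r)) r"
    have "annihilates \<iota> r' \<chi>"
      using \<open>annihilates \<iota> r \<chi>\<close> by (simp add: annihilates_def r'_def circ_smult[OF emb])
    moreover have "lead_coeff r' = 1" using \<open>r \<noteq> 0\<close> by (simp add: r'_def)
    ultimately have "degree f \<le> degree r'" by (intro least)
    moreover have "degree r' = degree r" using \<open>r \<noteq> 0\<close> by (simp add: r'_def)
    moreover have "degree r < degree f"
      using \<open>r \<noteq> 0\<close> f(1) degree_mod_less[of f h] by (cases "f = 0") (auto simp: r_def)
    ultimately show False by simp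
  qed
  then show "f dvd h" by (simp add: r_def dvd_eq_mod_eq_0)
qed

lemma normal_element_not_in_range_circ:
  fixes \<iota> :: "'k::finite_field \<Rightarrow> 'l::finite_field"
  assumes emb: "field_embedding \<iota>" and m: "m \<ge> 1" "CARD('l) = CARD('k) ^ m"
    and g: "lead_coeff g = 1" "g dvd monom 1 m - 1" "g \<noteq> 1"
    and normal: "normal_element \<iota> m \<alpha>"
  shows "\<alpha> \<notin> range (circ \<iota> g)"
proof
  assume "\<alpha> \<in> range (circ \<iota> g)"
  then obtain \<gamma> where \<gamma>: "\<alpha> = circ \<iota> g \<gamma>" by blast
  obtain h where h: "monom 1 m - 1 = h * g" using g(2) by (auto simp: dvd_def mult.commute)
  have deg: "degree (monom 1 m - 1 :: 'k poly) = m"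
    using m(1) degree_add_eq_left[of "-1 :: 'k poly" "monom 1 m"] by (simp add: degree_monom_eq)
  then have nz: "h \<noteq> 0" "g \<noteq> 0" using h m(1) g(1) by auto
  have "degree g > 0" using monic_degree_0[OF g(1)] g(3) by blast
  moreover have "degree h + degree g = m" using deg nz by (simp add: h degree_mult_eq)
  ultimately have "degree h < m" by simp
  moreover have "circ \<iota> h \<alpha> = circ \<iota> (monom 1 m - 1) \<gamma>" by (simp add: \<gamma> h circ_mult[OF emb])
  then have "circ \<iota> h \<alpha> = 0"
    using finite_field_power_card_eq_same[of \<gamma>] m(2)
    by (simp add: circ_diff[OF emb] circ_monom[OF emb] circ_1[OF emb])
  ultimately show False using normal_element_circ_eq_0[OF emb normal] nz by blast
qed

text \<open>
  The orthogonality argument: the characters annihilated by \<open>g\<close> form a group under pointwise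
  multiplication, and for \<open>g \<noteq> 1\<close> evaluation at \<open>\<alpha>\<close> is a nontrivial character of that group.
\<close>
lemma sum_annihilated_characters:
  fixes \<iota> :: "'k::finite_field \<Rightarrow> 'l::finite_field"
  assumes emb: "field_embedding \<iota>" and m: "m \<ge> 1" "CARD('l) = CARD('k) ^ m"
    and g: "lead_coeff g = 1" "g dvd monom 1 m - 1"
    and normal: "normal_element \<iota> m \<alpha>"
  shows "(\<Sum>\<chi> | additive_character \<chi> \<and> annihilates \<iota> g \<chi>. \<chi> \<alpha>) = (if g = 1 then 1 else 0)"
proof (cases "g = 1")
  case True
  then have "{\<chi> :: 'l \<Rightarrow> complex. additive_character \<chi> \<and> annihilates \<iota> g \<chi>} = {\<lambda>_. 1}"
    by (auto simp: annihilates_1[OF emb] additive_character_def)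
  then show ?thesis using True by simp
next
  case False
  let ?C = "{\<chi> :: 'l \<Rightarrow> complex. additive_character \<chi> \<and> annihilates \<iota> g \<chi>}"
  let ?T = "\<Sum>\<chi>\<in>?C. \<chi> \<alpha>"
  have zero: "0 \<in> range (circ \<iota> g)" using rangeI[of "circ \<iota> g" 0] circ_0_right[OF emb, of g] by simp
  have closed: "x + y \<in> range (circ \<iota> g)" if "x \<in> range (circ \<iota> g)" "y \<in> range (circ \<iota> g)" for x y
    using that by (auto simp flip: circ_add_right[OF emb])
  have notin: "\<alpha> \<notin> range (circ \<iota> g)"
    using normal_element_not_in_range_circ[OF emb m g False normal] .
  obtain \<psi> where \<psi>: "additive_character \<psi>" "\<forall>x\<in>range (circ \<iota> g). \<psi> x = 1" "\<psi> \<alpha> \<noteq> 1"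
    by (rule separating_character[OF zero closed notin])
  have nz: "\<psi> x \<noteq> 0" for x using \<psi>(1) by (auto simp: additive_character_def)
  have "?T = (\<Sum>\<chi>\<in>?C. \<psi> \<alpha> * \<chi> \<alpha>)"
    by (rule sum.reindex_bij_witness[of _ "\<lambda>\<chi> x. \<psi> x * \<chi> x" "\<lambda>\<chi> x. \<chi> x / \<psi> x"])
      (use \<psi> nz in \<open>auto simp: additive_character_def annihilates_def\<close>)
  also have "\<dots> = \<psi> \<alpha> * ?T" by (rule sum_distrib_left[symmetric])
  finally have "?T = \<psi> \<alpha> * ?T" .
  then have "(\<psi> \<alpha> - 1) * ?T = 0" by (simp only: left_diff_distrib) simp
  then show ?thesis using \<psi>(3) False by simp
qed

section \<open>Summing over the characters of a given Order\<close>

theorem mainTheorem2: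
  fixes \<iota> :: "'k::finite_field \<Rightarrow> 'l::finite_field"
    and m :: nat and g :: "'k poly" and \<alpha> :: 'l
  assumes "field_embedding \<iota>"
    and "m \<ge> 1"
    and "CARD('l) = CARD('k) ^ m"
    and "lead_coeff g = 1"
    and "g dvd monom 1 m - 1"
    and "normal_element \<iota> m \<alpha>"
  shows "(\<Sum>\<chi> | additive_character \<chi> \<and> Fq_Order \<iota> \<chi> = g. \<chi> \<alpha>) = of_int (poly_moebius g)"
proof -
  let ?S = "\<lambda>d. \<Sum>\<chi> | additive_character \<chi> \<and> Fq_Order \<iota> \<chi> = d. \<chi> \<alpha>"
  have "(\<Sum>d | lead_coeff d = 1 \<and> d dvd h. ?S d) = (if h = 1 then 1 else 0)"
    if h: "lead_coeff h = 1" "h dvd monom 1 m - 1" for h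
  proof -
    let ?C = "{\<chi>. additive_character \<chi> \<and> annihilates \<iota> h \<chi>}"
    let ?D = "{d. lead_coeff d = 1 \<and> d dvd h}"
    have order: "is_Fq_Order \<iota> \<chi> (Fq_Order \<iota> \<chi>)" if "additive_character \<chi>" for \<chi>
      using is_Fq_Order_Fq_Order[OF assms(1) that assms(3,2)] .
    have dvd: "annihilates \<iota> h \<chi> \<longleftrightarrow> Fq_Order \<iota> \<chi> dvd h" if "additive_character \<chi>" for \<chi>
      using annihilates_iff_Fq_Order_dvd[OF assms(1) that order[OF that]] .
    have "h \<noteq> 0" using h(1) by auto
    then have "finite ?D" by (intro rev_finite_subset[OF finite_poly_divisors[of h]]) auto
    moreover have "finite ?C" by (rule rev_finite_subset[OF finite_additive_characters]) auto
    moreover have "Fq_Order \<iota> ` ?C \<subseteq> ?D" using order dvd by (auto simp: is_Fq_Order_def)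
    ultimately have "(\<Sum>\<chi>\<in>?C. \<chi> \<alpha>) = (\<Sum>d\<in>?D. \<Sum>\<chi> | \<chi> \<in> ?C \<and> Fq_Order \<iota> \<chi> = d. \<chi> \<alpha>)"
      by (intro sum.group[symmetric])
    also have "\<dots> = (\<Sum>d\<in>?D. ?S d)"
      by (intro sum.cong refl) (use dvd in auto)
    finally show ?thesis
      using sum_annihilated_characters[OF assms(1-3) h assms(6)] by simp
  qed
  from poly_moebius_unique[of "monom 1 m - 1" ?S, OF this assms(4,5)] show ?thesis .
qed

end
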